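(* Let $(X,B)$ be a partial Steiner triple system of order $n$. Suppose that there are $n-1$ distinct points $x\in X$ for each of which there is an almost parallel class of $(X,B)$ that does not contain $x$. Then $(X,B)$ is nonsequenceable.
   Context: A partial Steiner triple system of order $n$ is a pair $(X,B)$, where $X$ is an $n$-element set of points and $B$ is a collection of $3$-element subsets of $X$ called blocks, such that every pair of distinct points is contained in at most one block (equivalently, the blocks are the vertex sets of triangles decomposing a subgraph of the complete graph on $X$). A Steiner triple system of order $n$, in which every pair of distinct points is contained in exactly one block, is included as a special case. A partial parallel class is a set of pairwise disjoint blocks. An almost parallel class is a partial parallel class whose blocks together contain all but exactly one of the points. It "does not contain $x$" if $x$ is in none of its blocks, i.e. $x$ is the one missed point. A sequencing of $(X,B)$ is an ordering $x_1x_2\cdots x_n$ of all the points of $X$, each appearing exactly once. A proper segment is a nonempty set of consecutive terms $x_i x_{i+1}\cdots x_j$ ($1\le i\le j\le n$) that is not the whole sequence. A segment can be partitioned into blocks if its set of points is a disjoint union of blocks in $B$. The system is sequenceable if there is a sequencing in which no proper segment can be partitioned into blocks; such a sequence is called admissible. The system is nonsequenceable if it has no admissible sequence.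
   Formalization: The formal statement assumes n ≥ 2: for n = 1 the claim fails (X = {x} with no blocks satisfies the hypothesis vacuously, yet its one-term sequence is admissible), and for n = 0 "n−1 points" is meaningless. *)

theory Defs
  imports Main "HOL-Library.Disjoint_Sets" "HOL-Library.Sublist"
begin

definition partial_STS :: "nat \<Rightarrow> 'a set \<Rightarrow> 'a set set \<Rightarrow> bool" where
  "partial_STS n X B \<longleftrightarrow>
     finite X \<and> card X = n \<and>
     (\<forall>b\<in>B. b \<subseteq> X \<and> card b = 3) \<and>
     (\<forall>x\<in>X. \<forall>y\<in>X. x \<noteq> y \<longrightarrow>
        (\<forall>b\<in>B. \<forall>c\<in>B. {x, y} \<subseteq> b \<and> {x, y} \<subseteq> c \<longrightarrow> b = c))"

definition partial_parallel_class :: "'a set set \<Rightarrow> 'a set set \<Rightarrow> bool" where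
  "partial_parallel_class B P \<longleftrightarrow> P \<subseteq> B \<and> disjoint P"

definition almost_parallel_class :: "'a set \<Rightarrow> 'a set set \<Rightarrow> 'a set set \<Rightarrow> bool" where
  "almost_parallel_class X B P \<longleftrightarrow>
     partial_parallel_class B P \<and> (\<exists>!x. x \<in> X \<and> x \<notin> \<Union>P)"

definition sequencing :: "'a set \<Rightarrow> 'a list \<Rightarrow> bool" where
  "sequencing X xs \<longleftrightarrow> distinct xs \<and> set xs = X"

definition proper_segment :: "'a list \<Rightarrow> 'a list \<Rightarrow> bool" where
  "proper_segment ys xs \<longleftrightarrow> sublist ys xs \<and> ys \<noteq> [] \<and> ys \<noteq> xs"

definition partitionable_into_blocks :: "'a set set \<Rightarrow> 'a list \<Rightarrow> bool" where
  "partitionable_into_blocks B ys \<longleftrightarrow> (\<exists>P. P \<subseteq> B \<and> disjoint P \<and> \<Union>P = set ys)"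

definition admissible :: "'a set \<Rightarrow> 'a set set \<Rightarrow> 'a list \<Rightarrow> bool" where
  "admissible X B xs \<longleftrightarrow>
     sequencing X xs \<and> (\<forall>ys. proper_segment ys xs \<longrightarrow> \<not> partitionable_into_blocks B ys)"

definition sequenceable :: "'a set \<Rightarrow> 'a set set \<Rightarrow> bool" where
  "sequenceable X B \<longleftrightarrow> (\<exists>xs. admissible X B xs)"

abbreviation nonsequenceable :: "'a set \<Rightarrow> 'a set set \<Rightarrow> bool" where
  "nonsequenceable X B \<equiv> \<not> sequenceable X B"

end

theory Submission
  imports Defs
begin

text \<open>
  In a sequencing of at least two points the first and the last term are distinct, and at most one
  point lacks an almost parallel class missing it; so some almost parallel class misses an
  endpoint. Its blocks partition the proper segment that remains after deleting that endpoint.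
\<close>

lemma almost_parallel_class_Union_eq:
  assumes "almost_parallel_class X B P" "\<And>b. b \<in> B \<Longrightarrow> b \<subseteq> X" "x \<in> X" "x \<notin> \<Union>P"
  shows "\<Union>P = X - {x}"
proof -
  have "\<Union>P \<subseteq> X"
    using assms(1,2) unfolding almost_parallel_class_def partial_parallel_class_def by blast
  moreover have "y = x" if "y \<in> X" "y \<notin> \<Union>P" for y
    using assms(1,3,4) that unfolding almost_parallel_class_def by blast
  ultimately show ?thesis
    using assms(4) by blast
qed

lemma partitionable_into_blocks_if_almost_parallel_class:
  assumes "almost_parallel_class X B P" "\<And>b. b \<in> B \<Longrightarrow> b \<subseteq> X" "x \<in> X" "x \<notin> \<Union>P"
    and "set ys = X - {x}"
  shows "partitionable_into_blocks B ys"
  using almost_parallel_class_Union_eq[OF assms(1-4)] assms(1,5)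
  unfolding partitionable_into_blocks_def almost_parallel_class_def partial_parallel_class_def
  by auto

theorem theorem1p1:
  fixes n :: nat and X :: "'a set" and B :: "'a set set"
  assumes "partial_STS n X B"
    and "n \<ge> 2"
    and "\<exists>S \<subseteq> X. card S = n - 1 \<and>
           (\<forall>x\<in>S. \<exists>P. almost_parallel_class X B P \<and> x \<notin> \<Union>P)"
  shows "nonsequenceable X B"
proof
  assume "sequenceable X B"
  then obtain xs where dist: "distinct xs" and set: "set xs = X"
    and adm: "\<And>ys. proper_segment ys xs \<Longrightarrow> \<not> partitionable_into_blocks B ys"
    unfolding sequenceable_def admissible_def sequencing_def by blast
  from assms(1) have fin: "finite X" and card: "card X = n" and blocks: "\<And>b. b \<in> B \<Longrightarrow> b \<subseteq> X"
    unfolding partial_STS_def by auto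
  from assms(3) obtain S where S: "S \<subseteq> X" "card S = n - 1"
    and apc: "\<And>x. x \<in> S \<Longrightarrow> \<exists>P. almost_parallel_class X B P \<and> x \<notin> \<Union>P"
    by blast
  have "length xs \<ge> 2"
    using dist set card assms(2) distinct_card by fastforce
  then obtain a ws where ws: "xs = a # ws" "ws \<noteq> []"
    by (cases xs) force+
  then obtain vs z where xs: "xs = a # vs @ [z]"
    by (metis rev_exhaust)
  have "a \<in> S \<or> z \<in> S"
  proof (rule ccontr)
    assume "\<not> (a \<in> S \<or> z \<in> S)"
    then have "S \<subseteq> X - {a, z}"
      using S(1) by blast
    then have "card S \<le> card (X - {a, z})"
      using fin by (intro card_mono) auto
    also have "card (X - {a, z}) = n - 2"
      using dist set card xs by (subst card_Diff_subset) auto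
    finally show False
      using S(2) assms(2) by simp
  qed
  moreover have False if "x \<in> S" "proper_segment ys xs" "set ys = X - {x}" for x ys
    using apc[OF that(1)] adm[OF that(2)] that(1,3) S(1) blocks
      partitionable_into_blocks_if_almost_parallel_class by (metis subsetD)
  moreover have "proper_segment (vs @ [z]) xs" "set (vs @ [z]) = X - {a}"
    using dist set xs by (auto simp: proper_segment_def sublist_Cons_right)
  moreover have "proper_segment (a # vs) xs" "set (a # vs) = X - {z}"
    using dist set xs by (auto simp: proper_segment_def sublist_def)
  ultimately show False
    by blast
qed

end
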